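(* Let $f:\mathbb{R}^n\to\mathbb{R}$ be twice continuously differentiable with $L_H$-Lipschitz continuous gradient on $\mathbb{R}^n$, with nonempty set of minimizers, minimal value $f_*$, and with $\{x:f(x)\le f(x_0)\}$ bounded for every $x_0\in\mathbb{R}^n$. Let $\{x_k\}_{k\in\mathbb{N}}$ be a sequence generated by the inexact regularized Newton method with unit step size described in the context, with parameter $\delta\in[0,1]$. Then a point with $\|\nabla f(x_k)\|\le\epsilon$ is reached within at most $\mathcal{O}(\epsilon^{-2-\delta})$ iterations: there is a constant $C>0$, depending only on $L_H$, $c$, $\mu_1$, $\mu_2$ and $f(x_0)-f_*$, such that for every $\epsilon\in(0,1]$ there is an index $k\le C\epsilon^{-2-\delta}$ with $\|\nabla f(x_k)\|\le\epsilon$.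
   Context: $\|\cdot\|$ is the Euclidean norm, $\lambda_{\min}$ the smallest eigenvalue. Inexact regularized Newton method with unit step size. Parameters: $x_0\in\mathbb{R}^n$, $c>0$, $\mu_1\in(0,1]$, $\mu_2\in(0,\mu_1]$, $\delta\in[0,1]$ (convention $0^0=1$). For $k=0,1,\dots$, set $$\varsigma_k=\max\{0,-\lambda_{\min}(\nabla^2f(x_k))\}+L_H+c+\mu_1\min\{1,\|\nabla f(x_k)\|^{\delta}\},$$ choose $d_k\in\mathbb{R}^n$ with $$\|(\nabla^2f(x_k)+\varsigma_kI)d_k+\nabla f(x_k)\|\le\frac{\mu_2}{2}\min\{1,\|\nabla f(x_k)\|^{\delta}\}\|d_k\|,$$ and set $x_{k+1}=x_k+d_k$. *)

theory Defs
  imports "HOL-Analysis.Analysis" "HOL-Library.Poly_Mapping"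
begin

text \<open>
  The complexity constant must not depend on the dimension, so the dimension has to be
  quantified inside the formula, which a type such as \<open>real ^ 'n\<close> does not allow.
  Therefore all the spaces \<open>\<real>\<^sup>n\<close> are placed in one type, that of finitely supported
  real sequences with the Euclidean inner product, as the subspaces of the sequences
  vanishing from index \<open>n\<close> on. Derivatives, continuity etc. are the library ones, taken
  within that subspace.
\<close>

instantiation poly_mapping :: (type, real_inner) real_inner
begin

lift_definition scaleR_poly_mapping :: "real \<Rightarrow> ('a \<Rightarrow>\<^sub>0 'b) \<Rightarrow> ('a \<Rightarrow>\<^sub>0 'b)"
  is "\<lambda>r f i. r *\<^sub>R f i"
proof -
  fix r :: real and f :: "'a \<Rightarrow> 'b"
  assume "finite {i. f i \<noteq> 0}"
  then show "finite {i. r *\<^sub>R f i \<noteq> 0}"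
    by (rule rev_finite_subset) auto
qed

definition inner_poly_mapping :: "('a \<Rightarrow>\<^sub>0 'b) \<Rightarrow> ('a \<Rightarrow>\<^sub>0 'b) \<Rightarrow> real"
  where "inner_poly_mapping x y =
    (\<Sum>i\<in>Poly_Mapping.keys x \<inter> Poly_Mapping.keys y. poly_mapping.lookup x i \<bullet> poly_mapping.lookup y i)"

definition norm_poly_mapping :: "('a \<Rightarrow>\<^sub>0 'b) \<Rightarrow> real"
  where "norm_poly_mapping x = sqrt (x \<bullet> x)"

definition sgn_poly_mapping :: "('a \<Rightarrow>\<^sub>0 'b) \<Rightarrow> ('a \<Rightarrow>\<^sub>0 'b)"
  where "sgn_poly_mapping x = inverse (norm x) *\<^sub>R x"

definition dist_poly_mapping :: "('a \<Rightarrow>\<^sub>0 'b) \<Rightarrow> ('a \<Rightarrow>\<^sub>0 'b) \<Rightarrow> real"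
  where "dist_poly_mapping x y = norm (x - y)"

definition uniformity_poly_mapping :: "(('a \<Rightarrow>\<^sub>0 'b) \<times> ('a \<Rightarrow>\<^sub>0 'b)) filter"
  where "uniformity_poly_mapping = (INF e\<in>{0<..}. principal {(x, y). dist x y < e})"

definition open_poly_mapping :: "('a \<Rightarrow>\<^sub>0 'b) set \<Rightarrow> bool"
  where "open_poly_mapping U \<longleftrightarrow> (\<forall>x\<in>U. \<forall>\<^sub>F (x', y) in uniformity. x' = x \<longrightarrow> y \<in> U)"

instance
proof
  have inner_superset: "x \<bullet> y = (\<Sum>i\<in>K. poly_mapping.lookup x i \<bullet> poly_mapping.lookup y i)"
    if "finite K" "Poly_Mapping.keys x \<subseteq> K" for x y :: "'a \<Rightarrow>\<^sub>0 'b" and K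
    unfolding inner_poly_mapping_def
    by (rule sum.mono_neutral_left) (use that in \<open>auto simp: in_keys_iff\<close>)
  fix x y z :: "'a \<Rightarrow>\<^sub>0 'b" and r s :: real
  show "r *\<^sub>R (x + y) = r *\<^sub>R x + r *\<^sub>R y" "(r + s) *\<^sub>R x = r *\<^sub>R x + s *\<^sub>R x"
    "r *\<^sub>R s *\<^sub>R x = (r * s) *\<^sub>R x" "1 *\<^sub>R x = x"
    by (auto intro!: poly_mapping_eqI
        simp: scaleR_poly_mapping.rep_eq lookup_add scaleR_add_right scaleR_add_left)
  show "x \<bullet> y = y \<bullet> x"
    by (simp add: inner_poly_mapping_def inner_commute Int_commute)
  show "(x + y) \<bullet> z = x \<bullet> z + y \<bullet> z"
    using keys_add[of x y]
    by (subst (1 2 3) inner_superset[of "Poly_Mapping.keys x \<union> Poly_Mapping.keys y"])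
      (auto simp: lookup_add inner_add_left sum.distrib)
  show "(r *\<^sub>R x) \<bullet> y = r * (x \<bullet> y)"
    by (subst (1 2) inner_superset[of "Poly_Mapping.keys x"])
      (auto simp: scaleR_poly_mapping.rep_eq in_keys_iff sum_distrib_left)
  show "0 \<le> x \<bullet> x"
    by (simp add: inner_poly_mapping_def sum_nonneg)
  show "x \<bullet> x = 0 \<longleftrightarrow> x = 0"
  proof
    assume "x \<bullet> x = 0"
    then have "\<forall>i\<in>Poly_Mapping.keys x. poly_mapping.lookup x i \<bullet> poly_mapping.lookup x i = 0"
      by (simp add: inner_poly_mapping_def sum_nonneg_eq_0_iff)
    then show "x = 0"
      by (intro poly_mapping_eqI) (auto simp: in_keys_iff)
  qed (simp add: inner_poly_mapping_def)
qed (rule norm_poly_mapping_def sgn_poly_mapping_def dist_poly_mapping_def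
    uniformity_poly_mapping_def open_poly_mapping_def)+

end

definition Rn :: "nat \<Rightarrow> (nat \<Rightarrow>\<^sub>0 real) set"
  where "Rn n = {x. \<forall>i\<ge>n. poly_mapping.lookup x i = 0}"

lemma inner_Rn:
  assumes "x \<in> Rn n"
  shows "x \<bullet> y = (\<Sum>i<n. poly_mapping.lookup x i * poly_mapping.lookup y i)"
proof -
  have "Poly_Mapping.keys x \<subseteq> {..<n}"
    using assms by (auto simp: Rn_def in_keys_iff not_le[symmetric])
  then show ?thesis
    unfolding inner_poly_mapping_def
    by (intro sum.mono_neutral_cong_left) (auto simp: in_keys_iff)
qed

lemma norm_Rn:
  assumes "x \<in> Rn n"
  shows "norm x = sqrt (\<Sum>i<n. (poly_mapping.lookup x i)\<^sup>2)"
  by (simp add: norm_eq_sqrt_inner inner_Rn[OF assms] power2_eq_square)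

text \<open>
  \<open>f\<close> is twice continuously differentiable on \<open>\<real>\<^sup>n\<close> with gradient \<open>G\<close> and Hessian \<open>H\<close>;
  \<open>H x\<close> is the Hessian at \<open>x\<close> as a linear map. On \<open>\<real>\<^sup>n\<close>, \<open>G x\<close> and \<open>H x\<close> are determined
  by \<open>f\<close>; the values of \<open>f\<close>, \<open>G\<close>, \<open>H\<close> and \<open>H x\<close> outside \<open>\<real>\<^sup>n\<close> are irrelevant. As the
  dimension is finite, continuity of \<open>H\<close> amounts to continuity of \<open>x \<mapsto> H x h\<close> for
  every \<open>h\<close>.
\<close>

definition twice_cont_diff ::
  "nat \<Rightarrow> ((nat \<Rightarrow>\<^sub>0 real) \<Rightarrow> real) \<Rightarrow> ((nat \<Rightarrow>\<^sub>0 real) \<Rightarrow> (nat \<Rightarrow>\<^sub>0 real)) \<Rightarrow>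
    ((nat \<Rightarrow>\<^sub>0 real) \<Rightarrow> (nat \<Rightarrow>\<^sub>0 real) \<Rightarrow> (nat \<Rightarrow>\<^sub>0 real)) \<Rightarrow> bool"
  where "twice_cont_diff n f G H \<longleftrightarrow>
    (\<forall>x\<in>Rn n. G x \<in> Rn n \<and> (f has_derivative (\<lambda>h. G x \<bullet> h)) (at x within Rn n)) \<and>
    (\<forall>x\<in>Rn n. (G has_derivative H x) (at x within Rn n)) \<and>
    (\<forall>h\<in>Rn n. continuous_on (Rn n) (\<lambda>x. H x h))"

definition eigenvalues_Rn :: "nat \<Rightarrow> ((nat \<Rightarrow>\<^sub>0 real) \<Rightarrow> (nat \<Rightarrow>\<^sub>0 real)) \<Rightarrow> real set"
  where "eigenvalues_Rn n A = {l. \<exists>v\<in>Rn n. v \<noteq> 0 \<and> A v = l *\<^sub>R v}"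

definition lambda_min :: "nat \<Rightarrow> ((nat \<Rightarrow>\<^sub>0 real) \<Rightarrow> (nat \<Rightarrow>\<^sub>0 real)) \<Rightarrow> real"
  where "lambda_min n A = Min (eigenvalues_Rn n A)"

text \<open>Real power with \<open>0\<^sup>0 = 1\<close>, whereas \<open>0 powr 0 = 0\<close>.\<close>

definition rpow :: "real \<Rightarrow> real \<Rightarrow> real"
  where "rpow a p = (if p = 0 then 1 else a powr p)"

definition reg_param ::
  "nat \<Rightarrow> ((nat \<Rightarrow>\<^sub>0 real) \<Rightarrow> (nat \<Rightarrow>\<^sub>0 real)) \<Rightarrow>
    ((nat \<Rightarrow>\<^sub>0 real) \<Rightarrow> (nat \<Rightarrow>\<^sub>0 real) \<Rightarrow> (nat \<Rightarrow>\<^sub>0 real)) \<Rightarrow>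
    real \<Rightarrow> real \<Rightarrow> real \<Rightarrow> real \<Rightarrow> (nat \<Rightarrow>\<^sub>0 real) \<Rightarrow> real"
  where "reg_param n G H L c \<mu>1 \<delta> x =
    max 0 (- lambda_min n (H x)) + L + c + \<mu>1 * min 1 (rpow (norm (G x)) \<delta>)"

definition inexact_reg_newton ::
  "nat \<Rightarrow> ((nat \<Rightarrow>\<^sub>0 real) \<Rightarrow> (nat \<Rightarrow>\<^sub>0 real)) \<Rightarrow>
    ((nat \<Rightarrow>\<^sub>0 real) \<Rightarrow> (nat \<Rightarrow>\<^sub>0 real) \<Rightarrow> (nat \<Rightarrow>\<^sub>0 real)) \<Rightarrow>
    real \<Rightarrow> real \<Rightarrow> real \<Rightarrow> real \<Rightarrow> real \<Rightarrow>
    (nat \<Rightarrow> (nat \<Rightarrow>\<^sub>0 real)) \<Rightarrow> (nat \<Rightarrow> (nat \<Rightarrow>\<^sub>0 real)) \<Rightarrow> bool"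
  where "inexact_reg_newton n G H L c \<mu>1 \<mu>2 \<delta> x d \<longleftrightarrow>
    x 0 \<in> Rn n \<and>
    (\<forall>k. d k \<in> Rn n \<and>
      norm (H (x k) (d k) + reg_param n G H L c \<mu>1 \<delta> (x k) *\<^sub>R d k + G (x k))
        \<le> \<mu>2 / 2 * min 1 (rpow (norm (G (x k))) \<delta>) * norm (d k) \<and>
      x (Suc k) = x k + d k)"

end

theory Submission
  imports Defs
begin

text \<open>
  Since \<open>\<langle>d, H d\<rangle> \<ge> \<lambda>\<^sub>m\<^sub>i\<^sub>n \<parallel>d\<parallel>\<^sup>2\<close>, the regularization makes every step satisfy
  \<open>f (x + d) \<le> f x - c \<parallel>d\<parallel>\<^sup>2\<close>, by the descent lemma. As the Hessian is bounded by \<open>L\<close>, also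
  \<open>\<parallel>G x\<parallel> \<le> (3 L + c + 2) \<parallel>d\<parallel>\<close>. Hence each step with \<open>\<parallel>G x\<parallel> > \<epsilon>\<close> decreases \<open>f\<close> by a constant
  multiple of \<open>\<epsilon>\<^sup>2\<close>: because \<open>c > 0\<close>, even the order \<open>\<epsilon>\<^sup>-\<^sup>2\<close> is attained.
\<close>

section \<open>Derivatives within a subspace\<close>

text \<open>The line through \<open>x\<close> with direction \<open>h\<close> stays in
  \<open>S\<close>, so the chain rule turns the derivative relative to \<open>S\<close> into an
  ordinary one in the real parameter. Everything below then reduces to calculus in one
  variable.\<close>

lemma has_derivative_along_line:
  fixes F :: "'a::real_normed_vector \<Rightarrow> 'b::real_normed_vector"
  assumes S: "subspace S" "x \<in> S" "h \<in> S"
    and F: "(F has_derivative F') (at (x + t *\<^sub>R h) within S)"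
  shows "((\<lambda>s. F (x + s *\<^sub>R h)) has_derivative (\<lambda>s. s *\<^sub>R F' h)) (at t)"
proof -
  have img: "range (\<lambda>s. x + s *\<^sub>R h) \<subseteq> S"
    using S by (auto intro: subspace_add subspace_scale)
  have "((\<lambda>s. x + s *\<^sub>R h) has_derivative (\<lambda>s. s *\<^sub>R h)) (at t)"
    by (auto intro!: derivative_eq_intros)
  from diff_chain_within[OF this has_derivative_subset[OF F img]]
  have "((\<lambda>s. F (x + s *\<^sub>R h)) has_derivative (\<lambda>s. F' (s *\<^sub>R h))) (at t)"
    by (simp add: o_def)
  moreover have "F' (s *\<^sub>R h) = s *\<^sub>R F' h" for s
    using has_derivative_bounded_linear[OF F] by (simp add: linear_simps)
  ultimately show ?thesis by simp
qed

lemma has_real_derivative_along_line: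
  fixes f :: "'a::real_inner \<Rightarrow> real"
  assumes S: "subspace S" "x \<in> S" "h \<in> S"
    and grad: "\<forall>y\<in>S. (f has_derivative (\<lambda>h. G y \<bullet> h)) (at y within S)"
  shows "((\<lambda>s. f (x + s *\<^sub>R h)) has_real_derivative G (x + t *\<^sub>R h) \<bullet> h) (at t)"
proof -
  have "x + t *\<^sub>R h \<in> S"
    using S by (auto intro: subspace_add subspace_scale)
  from has_derivative_along_line[OF S bspec[OF grad this]] show ?thesis
    by (simp add: has_field_derivative_def mult.commute[of _ "G (x + t *\<^sub>R h) \<bullet> h"])
qed

text \<open>This form transfers closed conditions, such as membership in a closed subspace or a norm
  bound, from increments of \<open>F\<close> to its derivative.\<close>

lemma difference_quotient_along_line:
  fixes F :: "'a::real_normed_vector \<Rightarrow> 'b::real_normed_vector"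
  assumes S: "subspace S" "x \<in> S" "h \<in> S"
    and F: "(F has_derivative F') (at x within S)"
  shows "((\<lambda>t. (F (x + t *\<^sub>R h) - F x) /\<^sub>R t) \<longlongrightarrow> F' h) (at 0)"
proof -
  have "((\<lambda>s. F (x + s *\<^sub>R h)) has_vector_derivative F' h) (at 0)"
    using has_derivative_along_line[OF S, of F F' 0] F
    by (simp add: has_vector_derivative_def)
  then have "((\<lambda>t. norm (F (x + t *\<^sub>R h) - F x - t *\<^sub>R F' h) / norm t) \<longlongrightarrow> 0) (at 0)"
    by (simp add: has_vector_derivative_def has_derivative_at)
  then have "((\<lambda>t. norm ((F (x + t *\<^sub>R h) - F x) /\<^sub>R t - F' h)) \<longlongrightarrow> 0) (at 0)"
  proof (rule Lim_transform_eventually)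
    show "\<forall>\<^sub>F t in at 0. norm (F (x + t *\<^sub>R h) - F x - t *\<^sub>R F' h) / norm t
        = norm ((F (x + t *\<^sub>R h) - F x) /\<^sub>R t - F' h)"
    proof (unfold eventually_at_filter, intro always_eventually allI impI)
      fix t :: real assume "t \<noteq> 0"
      then have "(F (x + t *\<^sub>R h) - F x) /\<^sub>R t - F' h
          = (F (x + t *\<^sub>R h) - F x - t *\<^sub>R F' h) /\<^sub>R t"
        by (simp add: scaleR_diff_right)
      then show "norm (F (x + t *\<^sub>R h) - F x - t *\<^sub>R F' h) / norm t
          = norm ((F (x + t *\<^sub>R h) - F x) /\<^sub>R t - F' h)"
        by (simp only: norm_scaleR) (simp add: divide_inverse mult.commute)
    qed
  qed
  then show ?thesis
    by (simp only: tendsto_norm_zero_iff LIM_zero_iff)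
qed

text \<open>The difference quotients lie in \<open>S\<close>, which is closed, so their limit does
  too. This makes the Hessian an endomorphism of \<open>Rn n\<close>, a fact that
  \<open>twice_cont_diff\<close> does not state explicitly.\<close>

lemma derivative_mem_subspace:
  fixes F :: "'a::real_normed_vector \<Rightarrow> 'a"
  assumes S: "subspace S" "closed S" "x \<in> S" "h \<in> S"
    and F: "(F has_derivative F') (at x within S)" "F ` S \<subseteq> S"
  shows "F' h \<in> S"
proof (rule Lim_in_closed_set[OF S(2) _ _ difference_quotient_along_line[OF S(1,3,4) F(1)]])
  have "x + t *\<^sub>R h \<in> S" for t
    using S by (auto intro: subspace_add subspace_scale)
  then have "(F (x + t *\<^sub>R h) - F x) /\<^sub>R t \<in> S" for t
    using S F(2) by (auto intro!: subspace_diff subspace_scale)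
  then show "\<forall>\<^sub>F t in at 0. (F (x + t *\<^sub>R h) - F x) /\<^sub>R t \<in> S" by simp
qed simp

text \<open>The Lipschitz bound holds for each difference quotient and survives the limit. Applied
  to the gradient, it bounds the Hessian by \<open>L\<close>.\<close>

lemma norm_derivative_le_lipschitz:
  fixes F :: "'a::real_normed_vector \<Rightarrow> 'b::real_normed_vector"
  assumes S: "subspace S" "x \<in> S" "h \<in> S"
    and F: "(F has_derivative F') (at x within S)" and lip: "L-lipschitz_on S F"
  shows "norm (F' h) \<le> L * norm h"
proof (rule Lim_norm_ubound[OF _ difference_quotient_along_line[OF S F]])
  have "norm ((F (x + t *\<^sub>R h) - F x) /\<^sub>R t) \<le> L * norm h" if "t \<noteq> 0" for t
  proof -
    have "x + t *\<^sub>R h \<in> S"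
      using S by (auto intro: subspace_add subspace_scale)
    from lipschitz_onD[OF lip this S(2)]
    have "norm (F (x + t *\<^sub>R h) - F x) \<le> \<bar>t\<bar> * (L * norm h)"
      by (simp add: dist_norm mult_ac)
    then show ?thesis
      using that by (simp only: norm_scaleR) (simp add: divide_simps mult.commute)
  qed
  then show "\<forall>\<^sub>F t in at 0. norm ((F (x + t *\<^sub>R h) - F x) /\<^sub>R t) \<le> L * norm h"
    by (auto simp: eventually_at_filter)
qed simp

lemma descent_lemma:
  fixes f :: "'a::real_inner \<Rightarrow> real"
  assumes S: "subspace S" "x \<in> S" "h \<in> S"
    and grad: "\<forall>y\<in>S. (f has_derivative (\<lambda>h. G y \<bullet> h)) (at y within S)"
    and lip: "L-lipschitz_on S G"
  shows "f (x + h) \<le> f x + G x \<bullet> h + L / 2 * (norm h)\<^sup>2"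
proof -
  \<comment> \<open>The claim is \<open>\<psi> 1 \<le> \<psi> 0\<close>. The subtracted terms are
    chosen so that the derivative of \<open>\<psi>\<close> is nonpositive on [0, 1] by
    Cauchy-Schwarz and the Lipschitz bound.\<close>
  define \<psi> where "\<psi> t = f (x + t *\<^sub>R h) - t * (G x \<bullet> h) - L / 2 * t\<^sup>2 * (norm h)\<^sup>2" for t
  have "\<psi> 1 \<le> \<psi> 0"
  proof (rule DERIV_nonpos_imp_nonincreasing, simp, intro exI conjI)
    fix t :: real assume t: "0 \<le> t" "t \<le> 1"
    show "(\<psi> has_real_derivative
        G (x + t *\<^sub>R h) \<bullet> h - G x \<bullet> h - L * t * (norm h)\<^sup>2) (at t)"
      unfolding \<psi>_def
      by (auto intro!: derivative_eq_intros has_real_derivative_along_line[OF S grad])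
    have "x + t *\<^sub>R h \<in> S"
      using S by (auto intro: subspace_add subspace_scale)
    from lipschitz_onD[OF lip this S(2)]
    have "norm (G (x + t *\<^sub>R h) - G x) \<le> L * t * norm h"
      using t by (simp add: dist_norm)
    then have "norm (G (x + t *\<^sub>R h) - G x) * norm h \<le> L * t * norm h * norm h"
      by (rule mult_right_mono) simp
    moreover have "(G (x + t *\<^sub>R h) - G x) \<bullet> h \<le> norm (G (x + t *\<^sub>R h) - G x) * norm h"
      by (rule norm_cauchy_schwarz)
    ultimately show "G (x + t *\<^sub>R h) \<bullet> h - G x \<bullet> h - L * t * (norm h)\<^sup>2 \<le> 0"
      by (simp add: inner_diff_left power2_eq_square)
  qed
  then show ?thesis by (simp add: \<psi>_def)
qed

text \<open>
  The second difference is \<open>t\<^sup>2 \<langle>A v, u\<rangle>\<close> up to \<open>o(t\<^sup>2)\<close> and symmetric in \<open>u\<close> and \<open>v\<close>, which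
  yields the symmetry of the Hessian without using its continuity.
\<close>

lemma second_difference_estimate:
  fixes f :: "'a::real_inner \<Rightarrow> real"
  assumes S: "subspace S" "x \<in> S" "u \<in> S" "v \<in> S"
    and grad: "\<forall>y\<in>S. (f has_derivative (\<lambda>h. G y \<bullet> h)) (at y within S)"
    and hess: "(G has_derivative A) (at x within S)"
    and "e > 0"
  shows "\<forall>\<^sub>F t in at_right 0.
    \<bar>f (x + t *\<^sub>R u + t *\<^sub>R v) - f (x + t *\<^sub>R u) - f (x + t *\<^sub>R v) + f x - t\<^sup>2 * (A v \<bullet> u)\<bar>
      \<le> t\<^sup>2 * (e * (2 * (norm u + norm v))\<^sup>2)"
proof -
  define M where "M = norm u + norm v"
  have "M \<ge> 0" by (simp add: M_def)
  obtain r where "r > 0" and r: "\<And>y. y \<in> S \<Longrightarrow> norm (y - x) < r \<Longrightarrow>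
      norm (G y - G x - A (y - x)) \<le> e * norm (y - x)"
    using hess \<open>e > 0\<close> unfolding has_derivative_within_alt by metis
  have "bounded_linear A" using hess by (rule has_derivative_bounded_linear)
  \<comment> \<open>The restriction on \<open>t\<close> keeps every point used within distance
    \<open>r\<close> of \<open>x\<close>; the summand 1 covers the case
    \<open>M = 0\<close>.\<close>
  have est: "\<bar>f (x + t *\<^sub>R u + t *\<^sub>R v) - f (x + t *\<^sub>R u) - f (x + t *\<^sub>R v) + f x - t\<^sup>2 * (A v \<bullet> u)\<bar>
      \<le> t\<^sup>2 * (e * (2 * M)\<^sup>2)" if t: "0 < t" "t < r / (M + 1)" for t
  proof -
    have tM: "t * M < r"
    proof -
      have "t * M \<le> t * (M + 1)" using t by simp
      also have "\<dots> < r" using t \<open>M \<ge> 0\<close> by (simp add: field_simps)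
      finally show ?thesis .
    qed
    \<comment> \<open>The second difference is \<open>\<phi> t - \<phi> 0\<close>. The mean value
      theorem in the direction \<open>u\<close> trades it for a difference of gradients at two
      points near \<open>x\<close>.\<close>
    define \<phi> where "\<phi> s = f ((x + t *\<^sub>R v) + s *\<^sub>R u) - f (x + s *\<^sub>R u)" for s
    have xv: "x + t *\<^sub>R v \<in> S"
      using S by (auto intro: subspace_add subspace_scale)
    have "\<exists>s>0. s < t \<and> \<phi> t - \<phi> 0
        = (t - 0) * (G ((x + t *\<^sub>R v) + s *\<^sub>R u) \<bullet> u - G (x + s *\<^sub>R u) \<bullet> u)"
      unfolding \<phi>_def
      by (rule MVT2[OF t(1)])
        (intro DERIV_diff has_real_derivative_along_line[OF S(1) _ S(3) grad] xv S(2); assumption)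
    then obtain s where s: "0 < s" "s < t" and \<phi>: "\<phi> t - \<phi> 0
        = t * (G ((x + t *\<^sub>R v) + s *\<^sub>R u) \<bullet> u - G (x + s *\<^sub>R u) \<bullet> u)"
      by auto
    have le: "norm (t *\<^sub>R v + s *\<^sub>R u) \<le> t * M" "norm (s *\<^sub>R u) \<le> t * M"
    proof -
      have "norm (t *\<^sub>R v + s *\<^sub>R u) \<le> t * norm v + s * norm u"
        using norm_triangle_ineq[of "t *\<^sub>R v" "s *\<^sub>R u"] t s by simp
      moreover have "s * norm u \<le> t * norm u" using s by (intro mult_right_mono) auto
      moreover have "0 \<le> t * norm v" using t by simp
      moreover have "t * M = t * norm u + t * norm v" by (simp add: M_def distrib_left)
      moreover have "norm (s *\<^sub>R u) = s * norm u" using s by simp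
      ultimately show "norm (t *\<^sub>R v + s *\<^sub>R u) \<le> t * M" "norm (s *\<^sub>R u) \<le> t * M"
        by linarith+
    qed
    have rem: "norm (G (x + w) - G x - A w) \<le> e * (t * M)" if "w \<in> S" "norm w \<le> t * M" for w
    proof -
      have "norm (G (x + w) - G x - A w) \<le> e * norm w"
        using r[of "x + w"] that tM S by (auto intro: subspace_add)
      also have "\<dots> \<le> e * (t * M)" using that \<open>e > 0\<close> by simp
      finally show ?thesis .
    qed
    \<comment> \<open>These are the errors of linearizing \<open>G\<close> at the two points. In
      \<open>R1 - R2\<close> the contributions of \<open>G x\<close> and
      \<open>s *\<^sub>R A u\<close> cancel, which leaves \<open>t *\<^sub>R A v\<close> as the main
      term.\<close>
    define R1 where "R1 = G (x + (t *\<^sub>R v + s *\<^sub>R u)) - G x - A (t *\<^sub>R v + s *\<^sub>R u)"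
    define R2 where "R2 = G (x + s *\<^sub>R u) - G x - A (s *\<^sub>R u)"
    have R: "norm R1 \<le> e * (t * M)" "norm R2 \<le> e * (t * M)"
      unfolding R1_def R2_def using S le
      by (auto intro!: rem subspace_add subspace_scale)
    have "A (t *\<^sub>R v + s *\<^sub>R u) = t *\<^sub>R A v + s *\<^sub>R A u" "A (s *\<^sub>R u) = s *\<^sub>R A u"
      using \<open>bounded_linear A\<close> by (simp_all add: linear_simps)
    then have "\<phi> t - \<phi> 0 - t\<^sup>2 * (A v \<bullet> u) = t * ((R1 - R2) \<bullet> u)"
      unfolding \<phi> R1_def R2_def by (simp add: algebra_simps power2_eq_square)
    moreover have "\<bar>(R1 - R2) \<bullet> u\<bar> \<le> (2 * (e * (t * M))) * M"
    proof -
      have "\<bar>(R1 - R2) \<bullet> u\<bar> \<le> norm (R1 - R2) * norm u"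
        by (rule Cauchy_Schwarz_ineq2)
      also have "\<dots> \<le> (2 * (e * (t * M))) * M"
        using R norm_triangle_ineq4[of R1 R2] t \<open>M \<ge> 0\<close> \<open>e > 0\<close>
        by (intro mult_mono) (auto simp: M_def)
      finally show ?thesis .
    qed
    ultimately have "\<bar>\<phi> t - \<phi> 0 - t\<^sup>2 * (A v \<bullet> u)\<bar> \<le> t * ((2 * (e * (t * M))) * M)"
      using t by (simp add: abs_mult)
    also have "\<dots> \<le> t\<^sup>2 * (e * (2 * M)\<^sup>2)"
      using \<open>e > 0\<close> \<open>M \<ge> 0\<close> by (simp add: power2_eq_square mult_ac)
    finally show ?thesis by (simp add: \<phi>_def algebra_simps)
  qed
  have "r / (M + 1) > 0" using \<open>r > 0\<close> \<open>M \<ge> 0\<close> by simp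
  then show ?thesis
    unfolding eventually_at_right_field M_def[symmetric] using est by blast
qed

lemma hessian_symmetric:
  fixes f :: "'a::real_inner \<Rightarrow> real"
  assumes S: "subspace S" "x \<in> S" "u \<in> S" "v \<in> S"
    and grad: "\<forall>y\<in>S. (f has_derivative (\<lambda>h. G y \<bullet> h)) (at y within S)"
    and hess: "(G has_derivative A) (at x within S)"
  shows "A u \<bullet> v = A v \<bullet> u"
proof -
  define M where "M = (2 * (norm u + norm v))\<^sup>2"
  have "\<bar>A u \<bullet> v - A v \<bullet> u\<bar> \<le> 0 + e" if "e > 0" for e
  proof -
    have "M \<ge> 0" by (simp add: M_def)
    \<comment> \<open>Chosen so that \<open>2 * (e' * M) \<le> e\<close>; the summand 1 avoids
      division by zero.\<close>
    define e' where "e' = e / (2 * (M + 1))"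
    have e': "e' > 0" using that \<open>M \<ge> 0\<close> by (simp add: e'_def)
    \<comment> \<open>One common \<open>t\<close> serves both orders of \<open>u\<close> and
      \<open>v\<close>. The second difference is the same in both, so the triangle inequality
      compares the two bilinear terms.\<close>
    have "\<exists>t>0.
        \<bar>f (x + t *\<^sub>R u + t *\<^sub>R v) - f (x + t *\<^sub>R u) - f (x + t *\<^sub>R v) + f x - t\<^sup>2 * (A v \<bullet> u)\<bar>
          \<le> t\<^sup>2 * (e' * (2 * (norm u + norm v))\<^sup>2) \<and>
        \<bar>f (x + t *\<^sub>R v + t *\<^sub>R u) - f (x + t *\<^sub>R v) - f (x + t *\<^sub>R u) + f x - t\<^sup>2 * (A u \<bullet> v)\<bar>
          \<le> t\<^sup>2 * (e' * (2 * (norm v + norm u))\<^sup>2)"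
      using eventually_happens'[OF trivial_limit_at_right_real
          eventually_conj[OF eventually_at_right_less[of "0::real"]
            eventually_conj[OF second_difference_estimate[OF S grad hess e']
              second_difference_estimate[OF S(1,2,4,3) grad hess e']]]]
      by blast
    then obtain t where "t > 0" and t:
      "\<bar>f (x + t *\<^sub>R u + t *\<^sub>R v) - f (x + t *\<^sub>R u) - f (x + t *\<^sub>R v) + f x - t\<^sup>2 * (A v \<bullet> u)\<bar>
        \<le> t\<^sup>2 * (e' * M)"
      "\<bar>f (x + t *\<^sub>R u + t *\<^sub>R v) - f (x + t *\<^sub>R u) - f (x + t *\<^sub>R v) + f x - t\<^sup>2 * (A u \<bullet> v)\<bar>
        \<le> t\<^sup>2 * (e' * M)"
      by (auto simp: M_def algebra_simps)
    then have "\<bar>t\<^sup>2 * (A u \<bullet> v) - t\<^sup>2 * (A v \<bullet> u)\<bar> \<le> t\<^sup>2 * (e' * M) + t\<^sup>2 * (e' * M)"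
      by linarith
    moreover have "\<bar>t\<^sup>2 * (A u \<bullet> v) - t\<^sup>2 * (A v \<bullet> u)\<bar> = t\<^sup>2 * \<bar>A u \<bullet> v - A v \<bullet> u\<bar>"
      by (simp add: abs_mult flip: right_diff_distrib)
    ultimately have "t\<^sup>2 * \<bar>A u \<bullet> v - A v \<bullet> u\<bar> \<le> t\<^sup>2 * (2 * (e' * M))"
      by (simp add: algebra_simps)
    then have "\<bar>A u \<bullet> v - A v \<bullet> u\<bar> \<le> 2 * (e' * M)"
      using \<open>t > 0\<close> by (simp add: mult_le_cancel_left_pos)
    also have "\<dots> \<le> e"
      using \<open>M \<ge> 0\<close> that by (simp add: e'_def field_simps)
    finally show ?thesis by simp
  qed
  from field_le_epsilon[OF this] show ?thesis by simp
qed

section \<open>Eigenvalues of symmetric maps\<close>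

text \<open>A minimizer of the Rayleigh quotient on the compact unit sphere of \<open>S\<close> is
  an eigenvector by the first-order optimality condition, and the minimal value is the required
  lower bound.\<close>

lemma rayleigh_minimum_eigenvalue:
  fixes A :: "'a::real_inner \<Rightarrow> 'a"
  assumes S: "subspace S" "compact (S \<inter> sphere 0 1)" "w\<^sub>0 \<in> S" "w\<^sub>0 \<noteq> 0"
    and A: "bounded_linear A" "\<And>v. v \<in> S \<Longrightarrow> A v \<in> S"
      "\<And>u v. u \<in> S \<Longrightarrow> v \<in> S \<Longrightarrow> A u \<bullet> v = A v \<bullet> u"
  obtains l v where "v \<in> S" "v \<noteq> 0" "A v = l *\<^sub>R v"
    and "\<And>w. w \<in> S \<Longrightarrow> l * (norm w)\<^sup>2 \<le> A w \<bullet> w"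
proof -
  have "sgn w\<^sub>0 \<in> S \<inter> sphere 0 1"
    using S by (auto simp: sgn_div_norm intro: subspace_scale)
  then have "S \<inter> sphere 0 1 \<noteq> {}" by blast
  moreover have "continuous_on (S \<inter> sphere 0 1) (\<lambda>v. A v \<bullet> v)"
    by (intro continuous_intros linear_continuous_on A)
  ultimately obtain v where "v \<in> S \<inter> sphere 0 1"
    and "\<forall>w\<in>S \<inter> sphere 0 1. A v \<bullet> v \<le> A w \<bullet> w"
    using continuous_attains_inf[OF S(2), of "\<lambda>v. A v \<bullet> v"] by blast
  then have v: "v \<in> S" "norm v = 1"
    and min: "\<And>w. w \<in> S \<Longrightarrow> norm w = 1 \<Longrightarrow> A v \<bullet> v \<le> A w \<bullet> w"
    by auto
  define l where "l = A v \<bullet> v"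
  have lower: "l * (norm w)\<^sup>2 \<le> A w \<bullet> w" if "w \<in> S" for w
  proof (cases "w = 0")
    case False
    have "sgn w \<in> S" "norm (sgn w) = 1"
      using S that False by (auto simp: sgn_div_norm intro: subspace_scale)
    moreover have "A (sgn w) = inverse (norm w) *\<^sub>R A w"
      using A(1) by (simp add: sgn_div_norm linear_simps)
    ultimately have "l \<le> inverse (norm w) * (inverse (norm w) * (A w \<bullet> w))"
      using min[of "sgn w"] by (simp add: l_def sgn_div_norm)
    with False show ?thesis by (simp add: field_simps power2_eq_square)
  qed simp
  \<comment> \<open>the residual of the eigenvalue equation, as the direction of a first-order variation of \<open>v\<close>\<close>
  define z where "z = A v - l *\<^sub>R v"
  have "z \<in> S" using S v A by (auto simp: z_def intro: subspace_diff subspace_scale)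
  have vv: "v \<bullet> v = 1" using v by (simp add: dot_square_norm)
  \<comment> \<open>This expands the inequality \<open>lower\<close> at
    \<open>v + t *\<^sub>R z\<close>. The constant term vanishes because
    \<open>l = A v \<bullet> v\<close>, and by symmetry the linear coefficient is
    \<open>2 * (z \<bullet> z)\<close>.\<close>
  have q: "0 \<le> 2 * t * (z \<bullet> z) + t\<^sup>2 * (A z \<bullet> z - l * (norm z)\<^sup>2)" for t
  proof -
    have "v + t *\<^sub>R z \<in> S"
      using S v \<open>z \<in> S\<close> by (auto intro: subspace_add subspace_scale)
    from lower[OF this]
    have "l * ((v + t *\<^sub>R z) \<bullet> (v + t *\<^sub>R z)) \<le> A (v + t *\<^sub>R z) \<bullet> (v + t *\<^sub>R z)"
      by (simp add: dot_square_norm)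
    moreover have "A (v + t *\<^sub>R z) = A v + t *\<^sub>R A z"
      using A(1) by (simp add: linear_simps)
    moreover have "A z \<bullet> v = A v \<bullet> z" using A(3) \<open>z \<in> S\<close> v by blast
    moreover have "A v \<bullet> z - l * (v \<bullet> z) = z \<bullet> z"
      by (simp add: z_def inner_diff_left)
    ultimately show ?thesis
      using vv l_def unfolding dot_square_norm[symmetric]
      by (simp add: algebra_simps inner_commute[of z v] power2_eq_square)
  qed
  have "z \<bullet> z = 0"
  proof (rule ccontr)
    assume "z \<bullet> z \<noteq> 0"
    then have "z \<bullet> z > 0" by simp
    define b where "b = A z \<bullet> z - l * (norm z)\<^sup>2"
    \<comment> \<open>A negative step, so short that the quadratic term cannot outweigh the linear
      one; this violates \<open>q\<close>.\<close>
    define t where "t = - (z \<bullet> z) / (\<bar>b\<bar> + 1)"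
    have "2 * (z \<bullet> z) + t * b > 0"
    proof -
      have "\<bar>t * b\<bar> \<le> z \<bullet> z"
        using \<open>z \<bullet> z > 0\<close> by (simp add: t_def abs_mult field_simps)
      then show ?thesis using \<open>z \<bullet> z > 0\<close> by linarith
    qed
    moreover have "t < 0" using \<open>z \<bullet> z > 0\<close> by (simp add: t_def)
    ultimately have "t * (2 * (z \<bullet> z) + t * b) < 0"
      by (rule mult_neg_pos[rotated])
    with q[of t] show False by (simp add: b_def algebra_simps power2_eq_square)
  qed
  then have "A v = l *\<^sub>R v" by (simp add: z_def)
  with that v lower show thesis by fastforce
qed

text \<open>Unit eigenvectors for distinct eigenvalues are orthogonal, hence separated, and a
  compact sphere holds only finitely many of them. Finiteness is what gives the \<open>Min\<close>
  in \<open>lambda_min\<close> its intended meaning.\<close>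

lemma finite_eigenvalues:
  fixes A :: "'a::real_inner \<Rightarrow> 'a"
  assumes S: "subspace S" "compact (S \<inter> sphere 0 1)"
    and A: "bounded_linear A" "\<And>u v. u \<in> S \<Longrightarrow> v \<in> S \<Longrightarrow> A u \<bullet> v = A v \<bullet> u"
  shows "finite {l. \<exists>v\<in>S. v \<noteq> 0 \<and> A v = l *\<^sub>R v}" proof (rule ccontr)
  define E where "E = {l. \<exists>v\<in>S. v \<noteq> 0 \<and> A v = l *\<^sub>R v}"
  assume "\<not> ?thesis"
  then have inf: "infinite E" by (simp add: E_def)
  have "\<exists>v\<in>S. norm v = 1 \<and> A v = l *\<^sub>R v" if "l \<in> E" for l
  proof -
    from that obtain v where v: "v \<in> S" "v \<noteq> 0" "A v = l *\<^sub>R v"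
      by (auto simp: E_def)
    have "A (sgn v) = l *\<^sub>R sgn v"
      using A(1) v by (simp add: sgn_div_norm linear_simps)
    with v S show ?thesis
      by (intro bexI[of _ "sgn v"]) (auto simp: sgn_div_norm intro: subspace_scale)
  qed
  then have "\<forall>l\<in>E. \<exists>v. v \<in> S \<and> norm v = 1 \<and> A v = l *\<^sub>R v" by blast
  from bchoice[OF this] obtain e
    where e: "\<And>l. l \<in> E \<Longrightarrow> e l \<in> S \<and> norm (e l) = 1 \<and> A (e l) = l *\<^sub>R e l"
    by blast
  have orth: "e l \<bullet> e m = 0" if "l \<in> E" "m \<in> E" "l \<noteq> m" for l m
  proof -
    have "A (e l) \<bullet> e m = A (e m) \<bullet> e l" using A(2) e that by blast
    then have "(l - m) * (e l \<bullet> e m) = 0"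
      using e that by (simp add: inner_commute algebra_simps)
    with that show ?thesis by simp
  qed
  \<comment> \<open>infinitely many separated unit vectors would contradict the compactness of the sphere\<close>
  have sep: "dist (e l) (e m) \<ge> 1" if "l \<in> E" "m \<in> E" "l \<noteq> m" for l m
  proof -
    have "(dist (e l) (e m))\<^sup>2 = 2"
      using orth[OF that] e[OF that(1)] e[OF that(2)]
      by (simp add: dist_norm power2_norm_eq_inner inner_diff inner_commute norm_eq_1)
    then show ?thesis
      by (intro power2_le_imp_le[of 1]) auto
  qed
  have "inj_on e E" using sep by (fastforce intro: inj_onI)
  then have "infinite (e ` E)" using inf finite_image_iff by blast
  moreover have "e ` E \<subseteq> S \<inter> sphere 0 1" using e by auto
  ultimately obtain p where "p islimpt e ` E"
    using Heine_Borel_imp_Bolzano_Weierstrass[OF S(2)] by blast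
  moreover have "\<not> p islimpt e ` E"
    by (rule discrete_imp_not_islimpt[of 1]) (use sep in force)+
  ultimately show False by blast
qed

section \<open>The spaces \<open>Rn n\<close>\<close>

lemma subspace_Rn: "subspace (Rn n)"
  by (auto simp: subspace_def Rn_def lookup_add scaleR_poly_mapping.rep_eq)

lemma inner_single:
  fixes x :: "'a \<Rightarrow>\<^sub>0 real"
  shows "Poly_Mapping.single i 1 \<bullet> x = poly_mapping.lookup x i"
  by (cases "i \<in> Poly_Mapping.keys x") (auto simp: inner_poly_mapping_def in_keys_iff)

lemma closed_Rn: "closed (Rn n)"
proof -
  have "Rn n = (\<Inter>i\<in>{n..}. {x. Poly_Mapping.single i 1 \<bullet> x = 0})"
    by (auto simp: Rn_def inner_single)
  then show ?thesis
    by (auto intro!: closed_INT closed_hyperplane)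
qed

text \<open>The ambient space is infinite-dimensional, so bounded closed sets need not be compact
  there. Compactness comes by induction on \<open>n\<close>: each box is a continuous image of the
  previous box times an interval.\<close>

lemma compact_box_Rn: "compact {x \<in> Rn n. \<forall>i. \<bar>poly_mapping.lookup x i\<bar> \<le> 1}" (is "compact (?B n)")
proof (induction n)
  case 0
  have "?B 0 = {0}"
    by (auto simp: Rn_def intro!: poly_mapping_eqI)
  then show ?case by simp
next
  case (Suc n)
  define F where "F = (\<lambda>(x :: nat \<Rightarrow>\<^sub>0 real, t :: real). x + t *\<^sub>R Poly_Mapping.single n 1)"
  have lookup_F: "poly_mapping.lookup (F (x, t)) i = poly_mapping.lookup x i + (if i = n then t else 0)"
    for x t i
    by (simp add: F_def lookup_add scaleR_poly_mapping.rep_eq lookup_single when_def)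
  have "?B (Suc n) = F ` (?B n \<times> {-1..1})"
  proof (intro subset_antisym subsetI)
    fix x assume x: "x \<in> ?B (Suc n)"
    define t where "t = poly_mapping.lookup x n"
    define y where "y = x - t *\<^sub>R Poly_Mapping.single n 1"
    have y: "poly_mapping.lookup y i = (if i = n then 0 else poly_mapping.lookup x i)" for i
      by (simp add: y_def t_def lookup_minus scaleR_poly_mapping.rep_eq lookup_single when_def)
    have "y \<in> ?B n" using x by (auto simp: y Rn_def)
    moreover have "t \<in> {-1..1}" using x by (auto simp: t_def abs_le_iff minus_le_iff)
    moreover have "x = F (y, t)" by (simp add: F_def y_def)
    ultimately show "x \<in> F ` (?B n \<times> {-1..1})" by blast
  next
    fix x assume "x \<in> F ` (?B n \<times> {-1..1})"
    then show "x \<in> ?B (Suc n)" by (auto simp: lookup_F Rn_def)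
  qed
  moreover have "compact (F ` (?B n \<times> {-1..1}))"
    unfolding F_def case_prod_beta
    by (intro compact_continuous_image continuous_intros compact_Times Suc compact_Icc)
  ultimately show ?case by simp
qed

text \<open>By Cauchy-Schwarz against the coordinate vectors, the sphere is a closed part of the
  compact box.\<close>

lemma compact_sphere_Rn: "compact (Rn n \<inter> sphere 0 1)"
proof -
  have "\<bar>poly_mapping.lookup x i\<bar> \<le> 1" if "norm x = 1" for x :: "nat \<Rightarrow>\<^sub>0 real" and i
  proof -
    have "norm (Poly_Mapping.single i 1 :: nat \<Rightarrow>\<^sub>0 real) = 1"
      by (simp add: norm_eq_1 inner_single)
    then show ?thesis
      using Cauchy_Schwarz_ineq2[of "Poly_Mapping.single i 1" x] that by (simp add: inner_single)
  qed
  then have "Rn n \<inter> sphere 0 1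
      = {x \<in> Rn n. \<forall>i. \<bar>poly_mapping.lookup x i\<bar> \<le> 1} \<inter> sphere 0 1"
    by auto
  moreover have "closed (sphere (0 :: nat \<Rightarrow>\<^sub>0 real) 1)"
    unfolding sphere_def by (intro closed_Collect_eq continuous_intros)
  ultimately show ?thesis
    using compact_Int_closed[OF compact_box_Rn] by simp
qed

text \<open>The Rayleigh minimum \<open>l\<close> is an eigenvalue, so
  \<open>lambda_min n A \<le> l\<close> and the quadratic lower bound carries over. The bound
  \<open>- L\<close> comes from applying the norm bound to an eigenvector for
  \<open>lambda_min n A\<close>.\<close>

lemma lambda_min_bounds:
  assumes "n \<ge> 1"
    and A: "bounded_linear A" "\<And>v. v \<in> Rn n \<Longrightarrow> A v \<in> Rn n"
      "\<And>u v. u \<in> Rn n \<Longrightarrow> v \<in> Rn n \<Longrightarrow> A u \<bullet> v = A v \<bullet> u"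
    and L: "\<And>v. v \<in> Rn n \<Longrightarrow> norm (A v) \<le> L * norm v"
  shows "- L \<le> lambda_min n A"
    and "\<And>w. w \<in> Rn n \<Longrightarrow> lambda_min n A * (norm w)\<^sup>2 \<le> A w \<bullet> w"
proof -
  \<comment> \<open>A nonzero vector exists because \<open>n \<ge> 1\<close>; in \<open>Rn 0\<close>
    there would be no eigenvalue at all.\<close>
  have w0: "Poly_Mapping.single 0 1 \<in> Rn n" "Poly_Mapping.single 0 (1::real) \<noteq> (0 :: nat \<Rightarrow>\<^sub>0 real)"
    using assms(1) by (auto simp: Rn_def lookup_one when_def)
  obtain l v where v: "v \<in> Rn n" "v \<noteq> 0" "A v = l *\<^sub>R v"
    and l: "\<And>w. w \<in> Rn n \<Longrightarrow> l * (norm w)\<^sup>2 \<le> A w \<bullet> w"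
    using rayleigh_minimum_eigenvalue[OF subspace_Rn compact_sphere_Rn w0 A] by metis
  have fin: "finite (eigenvalues_Rn n A)"
    unfolding eigenvalues_Rn_def by (rule finite_eigenvalues[OF subspace_Rn compact_sphere_Rn A(1,3)])
  have "l \<in> eigenvalues_Rn n A" using v by (auto simp: eigenvalues_Rn_def)
  then have "lambda_min n A \<le> l" "lambda_min n A \<in> eigenvalues_Rn n A"
    using fin Min_in unfolding lambda_min_def by (auto intro: Min_le)
  then show "lambda_min n A * (norm w)\<^sup>2 \<le> A w \<bullet> w" if "w \<in> Rn n" for w
    using l[OF that] by (meson mult_right_mono order_trans zero_le_power2)
  from \<open>lambda_min n A \<in> eigenvalues_Rn n A\<close> obtain u
    where "u \<in> Rn n" "u \<noteq> 0" "A u = lambda_min n A *\<^sub>R u"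
    by (auto simp: eigenvalues_Rn_def)
  with L[of u] show "- L \<le> lambda_min n A" by simp
qed

section \<open>Complexity\<close>

text \<open>The algebra of a single step: \<open>m\<close> stands for the negative curvature
  correction, \<open>q\<close> for the truncated power of the gradient norm, and \<open>Hd\<close>
  for the Hessian applied to \<open>d\<close>. Both conclusions follow by solving the residual for
  \<open>g\<close>.\<close>

lemma regularized_step:
  fixes g d Hd :: "'a::real_inner"
  assumes res: "norm (Hd + (m + L + c + \<mu>\<^sub>1 * q) *\<^sub>R d + g) \<le> \<mu>\<^sub>2 / 2 * q * norm d"
    and Hd: "- m * (norm d)\<^sup>2 \<le> Hd \<bullet> d" "norm Hd \<le> L * norm d"
    and param: "0 < c" "0 < \<mu>\<^sub>2" "\<mu>\<^sub>2 \<le> \<mu>\<^sub>1" "\<mu>\<^sub>1 \<le> 1" "0 \<le> q" "q \<le> 1" "0 \<le> m" "m \<le> L"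
  shows "g \<bullet> d + L / 2 * (norm d)\<^sup>2 \<le> - c * (norm d)\<^sup>2"
    and "norm g \<le> (3 * L + c + 2) * norm d"
proof -
  define s where "s = m + L + c + \<mu>\<^sub>1 * q"
  define r where "r = Hd + s *\<^sub>R d + g"
  have r: "norm r \<le> \<mu>\<^sub>2 / 2 * q * norm d" using res by (simp add: r_def s_def)
  have g: "g = r - Hd - s *\<^sub>R d" by (simp add: r_def)
  have "\<mu>\<^sub>2 * q \<le> \<mu>\<^sub>1 * q" using param by (intro mult_right_mono) auto
  have "\<mu>\<^sub>1 * q \<le> 1" using param by (intro mult_le_one) auto
  have "0 \<le> \<mu>\<^sub>1 * q" using param by simp
  have "r \<bullet> d \<le> norm r * norm d" by (rule norm_cauchy_schwarz)
  also have "\<dots> \<le> (\<mu>\<^sub>2 / 2 * q * norm d) * norm d" using r by (rule mult_right_mono) simp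
  finally have "r \<bullet> d \<le> \<mu>\<^sub>2 / 2 * q * (norm d)\<^sup>2" by (simp add: power2_eq_square)
  with Hd(1) have "g \<bullet> d + L / 2 * (norm d)\<^sup>2 \<le> (\<mu>\<^sub>2 / 2 * q + m - s + L / 2) * (norm d)\<^sup>2"
    by (simp add: g inner_diff_left dot_square_norm algebra_simps)
  \<comment> \<open>Inserting \<open>s\<close>, the coefficient is
    \<open>\<mu>\<^sub>2 / 2 * q - \<mu>\<^sub>1 * q - L / 2 - c\<close>: the regularization absorbs
    the inexactness, the curvature and the Lipschitz term, and still leaves
    \<open>- c\<close>.\<close>
  also have "\<dots> \<le> (- c) * (norm d)\<^sup>2"
    using \<open>\<mu>\<^sub>2 * q \<le> \<mu>\<^sub>1 * q\<close> \<open>0 \<le> \<mu>\<^sub>1 * q\<close> \<open>0 \<le> m\<close> \<open>m \<le> L\<close>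
    by (intro mult_right_mono) (auto simp: s_def)
  finally show "g \<bullet> d + L / 2 * (norm d)\<^sup>2 \<le> - c * (norm d)\<^sup>2" .
  have "s \<ge> 0" using param by (simp add: s_def)
  have "norm g \<le> norm r + norm Hd + s * norm d"
    unfolding g using norm_triangle_ineq4[of "r - Hd" "s *\<^sub>R d"] norm_triangle_ineq4[of r Hd] \<open>s \<ge> 0\<close>
    by simp
  also have "\<dots> \<le> (\<mu>\<^sub>2 / 2 * q + L + s) * norm d"
    using r Hd(2) by (simp add: algebra_simps)
  \<comment> \<open>Here \<open>s \<le> 2 * L + c + 1\<close> and
    \<open>\<mu>\<^sub>2 / 2 * q \<le> 1 / 2\<close>, so the sum is at most
    \<open>3 * L + c + 3 / 2\<close>, rounded up.\<close>
  also have "\<dots> \<le> (3 * L + c + 2) * norm d"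
    using \<open>\<mu>\<^sub>2 * q \<le> \<mu>\<^sub>1 * q\<close> \<open>\<mu>\<^sub>1 * q \<le> 1\<close> param by (intro mult_right_mono) (auto simp: s_def)
  finally show "norm g \<le> (3 * L + c + 2) * norm d" .
qed

text \<open>The descent lemma and the step estimate give a decrease of at least
  \<open>c * (norm (d k))\<^sup>2\<close>; the gradient bound then replaces the step length by the
  gradient norm.\<close>

lemma inexact_reg_newton_decrease:
  assumes "0 < c" "0 < \<mu>2" "\<mu>2 \<le> \<mu>1" "\<mu>1 \<le> 1" "n \<ge> 1"
    and diff: "twice_cont_diff n f G H" and lip: "L-lipschitz_on (Rn n) G"
    and newton: "inexact_reg_newton n G H L c \<mu>1 \<mu>2 \<delta> x d"
  shows "x k \<in> Rn n"
    and "f (x (Suc k)) \<le> f (x k) - c / (3 * L + c + 2)\<^sup>2 * (norm (G (x k)))\<^sup>2"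
proof -
  note S = subspace_Rn[of n]
  have x0: "x 0 \<in> Rn n" and d: "\<And>k. d k \<in> Rn n" and step: "\<And>k. x (Suc k) = x k + d k"
    and res: "\<And>k. norm (H (x k) (d k) + reg_param n G H L c \<mu>1 \<delta> (x k) *\<^sub>R d k + G (x k))
        \<le> \<mu>2 / 2 * min 1 (rpow (norm (G (x k))) \<delta>) * norm (d k)"
    using newton by (auto simp: inexact_reg_newton_def)
  show xk: "x k \<in> Rn n"
    by (induction k) (simp_all add: x0 step d subspace_add[OF S])
  have G: "G ` Rn n \<subseteq> Rn n"
    and grad: "\<forall>y\<in>Rn n. (f has_derivative (\<lambda>h. G y \<bullet> h)) (at y within Rn n)"
    and hess: "(G has_derivative H (x k)) (at (x k) within Rn n)"
    using diff xk by (auto simp: twice_cont_diff_def)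
  have L: "norm (H (x k) v) \<le> L * norm v" if "v \<in> Rn n" for v
    by (rule norm_derivative_le_lipschitz[OF S xk that hess lip])
  have mem: "H (x k) v \<in> Rn n" if "v \<in> Rn n" for v
    by (rule derivative_mem_subspace[OF S closed_Rn xk that hess G])
  have sym: "H (x k) u \<bullet> v = H (x k) v \<bullet> u" if "u \<in> Rn n" "v \<in> Rn n" for u v
    by (rule hessian_symmetric[OF S xk that grad hess])
  have bl: "bounded_linear (H (x k))" using hess by (rule has_derivative_bounded_linear)
  have eig: "- L \<le> lambda_min n (H (x k))"
    "lambda_min n (H (x k)) * (norm (d k))\<^sup>2 \<le> H (x k) (d k) \<bullet> d k"
    using lambda_min_bounds[of n "H (x k)" L, OF \<open>n \<ge> 1\<close> bl mem sym L] d by blast+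
  have "0 \<le> L" using lip by (rule lipschitz_on_nonneg)
  define m where "m = max 0 (- lambda_min n (H (x k)))"
  define q where "q = min 1 (rpow (norm (G (x k))) \<delta>)"
  have q: "0 \<le> q" "q \<le> 1" by (auto simp: q_def rpow_def)
  have m: "0 \<le> m" "m \<le> L" using eig(1) \<open>0 \<le> L\<close> by (auto simp: m_def)
  have "- m * (norm (d k))\<^sup>2 \<le> lambda_min n (H (x k)) * (norm (d k))\<^sup>2"
    by (intro mult_right_mono) (auto simp: m_def)
  also have "\<dots> \<le> H (x k) (d k) \<bullet> d k" by (rule eig(2))
  finally have Hd: "- m * (norm (d k))\<^sup>2 \<le> H (x k) (d k) \<bullet> d k" .
  have "norm (H (x k) (d k) + (m + L + c + \<mu>1 * q) *\<^sub>R d k + G (x k)) \<le> \<mu>2 / 2 * q * norm (d k)"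
    using res[of k] by (simp add: reg_param_def m_def q_def)
  note regularized_step[OF this Hd L[OF d] assms(1-4) q m]
  note decr = this(1) and gbound = this(2)
  define K where "K = 3 * L + c + 2"
  have "K > 0" using \<open>0 \<le> L\<close> assms(1) by (simp add: K_def)
  have "(norm (G (x k)))\<^sup>2 \<le> (K * norm (d k))\<^sup>2"
    using gbound by (intro power_mono) (auto simp: K_def)
  then have "c / K\<^sup>2 * (norm (G (x k)))\<^sup>2 \<le> c / K\<^sup>2 * (K * norm (d k))\<^sup>2"
    using assms(1) by (intro mult_left_mono) auto
  also have "\<dots> = c * (norm (d k))\<^sup>2"
    using \<open>K > 0\<close> by (simp add: power_mult_distrib)
  finally have "c / K\<^sup>2 * (norm (G (x k)))\<^sup>2 \<le> c * (norm (d k))\<^sup>2" .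
  moreover have "f (x (Suc k)) \<le> f (x k) + G (x k) \<bullet> d k + L / 2 * (norm (d k))\<^sup>2"
    unfolding step by (rule descent_lemma[OF S xk d grad lip])
  ultimately show "f (x (Suc k)) \<le> f (x k) - c / (3 * L + c + 2)\<^sup>2 * (norm (G (x k)))\<^sup>2"
    using decr by (simp add: K_def)
qed

text \<open>Telescoping: as long as \<open>g\<close> exceeds \<open>\<epsilon>\<close>, each step
  costs at least \<open>a * \<epsilon>\<^sup>2\<close>, while the total decrease is at most
  \<open>D\<close>.\<close>

lemma small_value_of_decrease:
  fixes F :: "nat \<Rightarrow> real"
  assumes "0 < a" "0 < \<epsilon>" "0 \<le> B"
    and decr: "\<And>k. F (Suc k) \<le> F k - a * (g k)\<^sup>2"
    and bound: "\<And>k. F 0 - F k \<le> D"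
    and B: "D < a * B * \<epsilon>\<^sup>2"
  shows "\<exists>k. real k \<le> B \<and> g k \<le> \<epsilon>"
proof (rule ccontr)
  assume "\<not> ?thesis"
  then have big: "\<epsilon> < g k" if "real k \<le> B" for k using that by fastforce
  \<comment> \<open>The first \<open>k\<close> decreases involve only indices up to
    \<open>k - 1\<close>, hence the bound \<open>B + 1\<close> rather than \<open>B\<close>.\<close>
  have "real k \<le> B + 1 \<Longrightarrow> a * real k * \<epsilon>\<^sup>2 \<le> F 0 - F k" for k
  proof (induction k)
    case (Suc k)
    then have "\<epsilon>\<^sup>2 \<le> (g k)\<^sup>2"
      using big[of k] \<open>0 < \<epsilon>\<close> by (intro power_mono) auto
    then have "a * \<epsilon>\<^sup>2 \<le> a * (g k)\<^sup>2" using \<open>0 < a\<close> by simp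
    with Suc decr[of k] show ?case by (simp add: algebra_simps)
  qed simp
  moreover define N where "N = Suc (nat \<lfloor>B\<rfloor>)"
  have "real N \<le> B + 1" "B \<le> real N"
    using \<open>0 \<le> B\<close> by (auto simp: N_def; linarith)+
  ultimately have "a * real N * \<epsilon>\<^sup>2 \<le> D" using bound[of N] by force
  moreover have "a * B * \<epsilon>\<^sup>2 \<le> a * real N * \<epsilon>\<^sup>2"
    using \<open>B \<le> real N\<close> \<open>0 < a\<close> by (intro mult_right_mono mult_left_mono) auto
  ultimately show False using B by linarith
qed

text \<open>The gap \<open>\<Delta>\<close> is fixed together with \<open>L_H\<close>,
  \<open>c\<close>, \<open>\<mu>1\<close> and \<open>\<mu>2\<close> before \<open>C\<close>, whereas
  dimension, function, exponent and iterates are quantified after it. This order expresses on what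
  \<open>C\<close> may depend.\<close>

theorem mainTheorem6:
  fixes L_H c \<mu>1 \<mu>2 \<Delta> :: real
  assumes "c > 0" and "0 < \<mu>1" "\<mu>1 \<le> 1" and "0 < \<mu>2" "\<mu>2 \<le> \<mu>1"
  shows "\<exists>C>0. \<forall>(n::nat) f G H f_min \<delta> x d.
    n \<ge> 1 \<longrightarrow>
    twice_cont_diff n f G H \<longrightarrow>
    L_H-lipschitz_on (Rn n) G \<longrightarrow>
    (\<exists>z\<in>Rn n. f z = f_min \<and> (\<forall>y\<in>Rn n. f_min \<le> f y)) \<longrightarrow>
    (\<forall>y\<in>Rn n. bounded {z\<in>Rn n. f z \<le> f y}) \<longrightarrow>
    0 \<le> \<delta> \<longrightarrow> \<delta> \<le> 1 \<longrightarrow>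
    inexact_reg_newton n G H L_H c \<mu>1 \<mu>2 \<delta> x d \<longrightarrow>
    f (x 0) - f_min = \<Delta> \<longrightarrow>
    (\<forall>\<epsilon>. 0 < \<epsilon> \<and> \<epsilon> \<le> 1 \<longrightarrow>
      (\<exists>k::nat. real k \<le> C * \<epsilon> powr (- 2 - \<delta>) \<and> norm (G (x k)) \<le> \<epsilon>))"
proof -
  define a where "a = c / (3 * L_H + c + 2)\<^sup>2"
  \<comment> \<open>The summand 1 makes \<open>\<Delta> < a * C\<close> strict once
    \<open>a > 0\<close>. Positivity has to hold before any \<open>f\<close> is given: the absolute
    value covers negative \<open>\<Delta>\<close>, and if \<open>3 * L_H + c + 2 = 0\<close>, then
    division by zero yields \<open>a = 0\<close> and \<open>C = 1\<close>.\<close>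
  define C where "C = \<bar>\<Delta>\<bar> / a + 1"
  have "a \<ge> 0" using assms(1) by (simp add: a_def)
  then have "C > 0" by (simp add: C_def add_nonneg_pos)
  moreover have "\<exists>k::nat. real k \<le> C * \<epsilon> powr (- 2 - \<delta>) \<and> norm (G (x k)) \<le> \<epsilon>"
    if n: "n \<ge> 1" and diff: "twice_cont_diff n f G H" and lip: "L_H-lipschitz_on (Rn n) G"
      and min: "\<forall>y\<in>Rn n. f_min \<le> f y" and "0 \<le> \<delta>"
      and newton: "inexact_reg_newton n G H L_H c \<mu>1 \<mu>2 \<delta> x d"
      and \<Delta>: "f (x 0) - f_min = \<Delta>" and \<epsilon>: "0 < \<epsilon>" "\<epsilon> \<le> 1"
    for n f G H f_min \<delta> x d \<epsilon>
  proof -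
    note decrease = inexact_reg_newton_decrease[OF assms(1,4,5,3) n diff lip newton]
    have "3 * L_H + c + 2 > 0" using lipschitz_on_nonneg[OF lip] assms(1) by linarith
    then have "a > 0" using assms(1) by (simp add: a_def)
    have "\<Delta> < a * C"
      using \<open>a > 0\<close> by (simp add: C_def algebra_simps)
    also have "\<dots> = a * (C * \<epsilon> powr (- 2)) * \<epsilon>\<^sup>2"
      using \<epsilon> by (simp add: powr_minus powr_numeral)
    \<comment> \<open>As \<open>\<epsilon> \<le> 1\<close> and \<open>\<delta> \<ge> 0\<close>,
      lowering the exponent from -2 to \<open>- 2 - \<delta>\<close> can only increase the
      power.\<close>
    also have "\<dots> \<le> a * (C * \<epsilon> powr (- 2 - \<delta>)) * \<epsilon>\<^sup>2"
      using \<open>a > 0\<close> \<open>C > 0\<close> \<epsilon> \<open>0 \<le> \<delta>\<close>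
      by (intro mult_right_mono mult_left_mono powr_mono') auto
    finally have "\<Delta> < a * (C * \<epsilon> powr (- 2 - \<delta>)) * \<epsilon>\<^sup>2" .
    moreover have "f (x 0) - f (x k) \<le> \<Delta>" for k
      using min decrease(1)[of k] \<Delta> by force
    moreover have "f (x (Suc k)) \<le> f (x k) - a * (norm (G (x k)))\<^sup>2" for k
      using decrease(2) by (simp add: a_def)
    ultimately show ?thesis
      using \<open>C > 0\<close>
      by (intro small_value_of_decrease[where F = "\<lambda>k. f (x k)" and D = \<Delta>, OF \<open>a > 0\<close> \<epsilon>(1)]) auto
  qed
  ultimately show ?thesis by blast
qed

end
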